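(* Let $0<q<1$, $\gamma,\xi>-1$ and $c>0$. Put $y_n(z;q)=\mathfrak{P}_n^{(\gamma,\xi)}(z,c;q)$ for $n\in\mathbb{N}_0$, and $y_{-1}(z;q)=y_{-2}(z;q)=0$. Then these polynomials satisfy the four-term recurrence relation $$\mu_{q,1}(n)\,y_{n-2}(z;q)+\bigl(\mu_{q,2}(n)+z\,\mu_{q,5}(n)\bigr)y_{n-1}(z;q)+\bigl(\mu_{q,3}(n)+z\,\mu_{q,6}(n)\bigr)y_n(z;q)+\mu_{q,4}(n)\,y_{n+1}(z;q)=0,\qquad n\in\mathbb{N}_0,$$ where the coefficients are as follows. For $n\ge 2$: $$\begin{aligned} \mu_{q,6}(n)&=[q^{2n+\gamma+\xi+2};q]_2(1-q^{n+\gamma+\xi})(1-q^{n+1}),\\ \mu_{q,5}(n)&=-q(1-q^n)(1-q^{n+\gamma+\xi-1})[q^{2n+\gamma+\xi+2};q]_2,\\ \mu_{q,4}(n)&=q^n(1-q^{\gamma+n+1})(1-q^{c+n+1})[q^{n+\gamma+\xi+1};q]_2,\\ \mu_{q,3}(n)&=-(1-q^{2n+\gamma+\xi+1})(1-q^{n+\gamma+\xi})\Bigl(\tfrac{(1-q^{n+1})(1-q^{\gamma+n+1})(1-q^{c+n+1})}{1-q}\\ &\quad+\tfrac{q^n(1-q^{n+\gamma+\xi-1})(1-q^{\gamma+n})(1-q^{c+n})(1-q^{2n+\gamma+\xi+2})}{[q^{2n+\gamma+\xi};q]_2}-\tfrac{(1-q^{\gamma+n})(1-q^{c+n})(1-q^{2n+\gamma+\xi+2})(1-q^{n+1})}{(1-q)(1-q^{2n+\gamma+\xi})}\Bigr),\\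 \mu_{q,2}(n)&=\tfrac{(1-q^{2n+\gamma+\xi-1})[q^{n+1};q]_2(1-q^{\gamma+n+1})(1-q^{c+n+1})(1-q^{2n+\gamma+\xi+1})}{q^{n-1}(1-q)^2}\\ &\quad+\tfrac{q(1-q^{n+\gamma+\xi-1})(1-q^{\gamma+n})(1-q^{c+n})(1-q^n)[q^{2n+\gamma+\xi+2};q]_2}{(1-q)(1-q^{2n+\gamma+\xi})}\\ &\quad-\tfrac{(1-q^{2n+\gamma+\xi-1})(1-q^{\gamma+n})(1-q^{c+n})[q^{n+1};q]_2[q^{2n+\gamma+\xi+2};q]_2}{q^{n-1}(1-q)^2(1-q^{2n+\gamma+\xi})}\\ &\quad-\tfrac{[q^{2n+\gamma+\xi};q]_2(1-q^{\gamma+n+1})(1-q^{c+n+1})[q^{n+1};q]_2}{q^{n-2}[q^2;q]_2}\\ &\quad-\tfrac{q(1-q^{n+\gamma+\xi-1})(1-q^{\gamma+n-1})(1-q^{c+n-1})(1-q^n)[q^{2n+\gamma+\xi+2};q]_2}{(1-q)(1-q^{2n+\gamma+\xi-2})}\\ &\quad+\tfrac{[q^{2n+\gamma+\xi+2};q]_2(1-q^{\gamma+n-1})(1-q^{c+n-1})[q^{n+1};q]_2}{q^{n-2}[q^2;q]_2},\\ \mu_{q,1}(n)&=-\mu_{q,2}(n)-\mu_{q,3}(n)-\mu_{q,4}(n). \end{aligned}$$ For $n=0,1$, the coefficients $\mu_{q,1}(n),\mu_{q,4}(n),\mu_{q,5}(n),\mu_{q,6}(n)$ are given by the same expressions, while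 $$\begin{aligned} \mu_{q,2}(0)&=0,\\ \mu_{q,3}(0)&=-\Bigl((1-q^{\gamma+1})(1-q^{c+1})[q^{\gamma+\xi+1};q]_2+(1-q^{\gamma})(1-q^{c})[q^{\gamma+\xi+2};q]_2-(1-q^{\gamma})(1-q^{c})[q^{\gamma+\xi+2};q]_2\Bigr),\\ \mu_{q,2}(1)&=\tfrac{q(1-q^{\gamma+1})(1-q^{c+1})(1-q^{\gamma+\xi})[q^{\gamma+\xi+4};q]_2}{1-q^{\gamma+\xi+2}}+q(1-q^{\gamma})(1-q^{c})[q^{\gamma+\xi+4};q]_2\\ &\quad-q(1-q^{\gamma})(1-q^{c})[q^{\gamma+\xi+4};q]_2-q(1-q^{\gamma+2})(1-q^{c+2})[q^{\gamma+\xi+2};q]_2\\ &\quad+(1+q)(1-q^{\gamma+2})(1-q^{c+2})(1-q^{\gamma+\xi+1})(1-q^{\gamma+\xi+3})\\ &\quad-\tfrac{(1+q)(1-q^{\gamma+1})(1-q^{c+1})(1-q^{\gamma+\xi+1})[q^{\gamma+\xi+4};q]_2}{1-q^{\gamma+\xi+2}},\\ \mu_{q,3}(1)&=-(1-q^{\gamma+\xi+1})(1-q^{\gamma+\xi+3})\Bigl(\tfrac{q(1-q^{\gamma+1})(1-q^{c+1})(1-q^{\gamma+\xi})(1-q^{\gamma+\xi+4})}{[q^{\gamma+\xi+2};q]_2}\\ &\quad+(1+q)(1-q^{\gamma+2})(1-q^{c+2})-\tfrac{(1+q)(1-q^{\gamma+1})(1-q^{c+1})(1-q^{\gamma+\xi+4})}{1-q^{\gamma+\xi+2}}\Bigr).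 \end{aligned}$$
   Context: $(b;q)_0=1$ and $(b;q)_k=(1-b)(1-bq)\cdots(1-bq^{k-1})$ for $k\ge1$. The bracket symbol is $[b;q]_1=1-b$ and $[b;q]_2=(1-b)(1-bq^{-1})$. The generalized little $q$-Jacobi polynomial is $$\mathfrak{P}_n^{(\gamma,\xi)}(z,c;q)={}_3\phi_2\left[{q^{-n},\,q^{n+\gamma+\xi+1},\,q \atop q^{\gamma+1},\,q^{c+1}};q;qz\right]=\sum_{i=0}^{n}\frac{(q^{-n};q)_i\,(q^{n+\gamma+\xi+1};q)_i}{(q^{\gamma+1};q)_i\,(q^{c+1};q)_i}(qz)^i .$$ When $\gamma+\xi=-1$, the factor $1-q^{\gamma+\xi+1}$ in $[q^{\gamma+\xi+2};q]_2=(1-q^{\gamma+\xi+2})(1-q^{\gamma+\xi+1})$ in the denominator inside $\mu_{q,3}(1)$ is understood to be cancelled against the same factor in front of the parenthesis. *)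

theory Defs
  imports Complex_Main
begin

definition q_poch :: "'a::comm_ring_1 \<Rightarrow> 'a \<Rightarrow> nat \<Rightarrow> 'a" where
  "q_poch b q k = (\<Prod>j<k. 1 - b * q ^ j)"

definition q_bracket :: "'a::field \<Rightarrow> 'a \<Rightarrow> nat \<Rightarrow> 'a" where
  "q_bracket b q k = (\<Prod>j<k. 1 - b * inverse q ^ j)"

lemma q_bracket_1: "q_bracket b q 1 = 1 - b"
  by (simp add: q_bracket_def)

lemma q_bracket_2: "q_bracket b q 2 = (1 - b) * (1 - b * inverse q)"
  by (simp add: q_bracket_def numeral_2_eq_2)

definition phi_3_2 ::
  "complex \<Rightarrow> complex \<Rightarrow> complex \<Rightarrow> complex \<Rightarrow> complex \<Rightarrow> complex \<Rightarrow> complex \<Rightarrow> complex" where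
  "phi_3_2 a1 a2 a3 b1 b2 q z =
     (\<Sum>k. q_poch a1 q k * q_poch a2 q k * q_poch a3 q k /
           (q_poch q q k * q_poch b1 q k * q_poch b2 q k) * z ^ k)"

definition gen_little_q_jacobi ::
  "real \<Rightarrow> real \<Rightarrow> real \<Rightarrow> real \<Rightarrow> nat \<Rightarrow> complex \<Rightarrow> complex" where
  "gen_little_q_jacobi \<gamma> \<xi> c q n z =
     phi_3_2 (of_real (q powr (- real n))) (of_real (q powr (real n + \<gamma> + \<xi> + 1))) (of_real q)
       (of_real (q powr (\<gamma> + 1))) (of_real (q powr (c + 1))) (of_real q) (of_real q * z)"

lemma q_poch_of_real: "q_poch (of_real b) (of_real q) k = complex_of_real (q_poch b q k)"
  by (simp add: q_poch_def)

lemma q_poch_terminates: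
  fixes q :: real
  assumes "0 < q" "n < k"
  shows "q_poch (q powr (- real n)) q k = 0"
proof -
  have "q powr (- real n) * q ^ n = 1"
    using assms(1) by (simp add: powr_minus powr_realpow)
  with assms(2) show ?thesis
    by (auto simp: q_poch_def intro!: bexI[of _ n])
qed

lemma q_poch_self_nonzero:
  fixes q :: real
  assumes "0 < q" "q < 1"
  shows "q_poch q q k \<noteq> 0"
proof -
  have "q * q ^ j < 1" for j
    using assms power_Suc_less_one[of q j] by simp
  then show ?thesis
    by (auto simp: q_poch_def) (metis less_irrefl)
qed

lemma gen_little_q_jacobi_eq_sum:
  assumes "0 < q" "q < 1"
  shows "gen_little_q_jacobi \<gamma> \<xi> c q n z =
    (\<Sum>i\<le>n. of_real (q_poch (q powr (- real n)) q i * q_poch (q powr (real n + \<gamma> + \<xi> + 1)) q i /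
              (q_poch (q powr (\<gamma> + 1)) q i * q_poch (q powr (c + 1)) q i)) * (of_real q * z) ^ i)"
proof -
  have "gen_little_q_jacobi \<gamma> \<xi> c q n z =
    (\<Sum>i. of_real (q_poch (q powr (- real n)) q i * q_poch (q powr (real n + \<gamma> + \<xi> + 1)) q i /
              (q_poch (q powr (\<gamma> + 1)) q i * q_poch (q powr (c + 1)) q i)) * (of_real q * z) ^ i)"
    unfolding gen_little_q_jacobi_def phi_3_2_def q_poch_of_real
    using q_poch_self_nonzero[OF assms] by (intro suminf_cong) simp
  also have "\<dots> =
    (\<Sum>i\<le>n. of_real (q_poch (q powr (- real n)) q i * q_poch (q powr (real n + \<gamma> + \<xi> + 1)) q i /
              (q_poch (q powr (\<gamma> + 1)) q i * q_poch (q powr (c + 1)) q i)) * (of_real q * z) ^ i)"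
    by (rule suminf_finite) (auto simp: q_poch_terminates[OF assms(1)])
  finally show ?thesis .
qed

definition mu6 :: "real \<Rightarrow> real \<Rightarrow> real \<Rightarrow> real \<Rightarrow> nat \<Rightarrow> real" where
  "mu6 \<gamma> \<xi> c q n =
     q_bracket (q powr (2 * real n + \<gamma> + \<xi> + 2)) q 2 * (1 - q powr (real n + \<gamma> + \<xi>)) * (1 - q ^ (n + 1))"

definition mu5 :: "real \<Rightarrow> real \<Rightarrow> real \<Rightarrow> real \<Rightarrow> nat \<Rightarrow> real" where
  "mu5 \<gamma> \<xi> c q n =
     - q * (1 - q ^ n) * (1 - q powr (real n + \<gamma> + \<xi> - 1))
       * q_bracket (q powr (2 * real n + \<gamma> + \<xi> + 2)) q 2"

definition mu4 :: "real \<Rightarrow> real \<Rightarrow> real \<Rightarrow> real \<Rightarrow> nat \<Rightarrow> real" where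
  "mu4 \<gamma> \<xi> c q n =
     q ^ n * (1 - q powr (\<gamma> + real n + 1)) * (1 - q powr (c + real n + 1))
       * q_bracket (q powr (real n + \<gamma> + \<xi> + 1)) q 2"

(* For n = 1 the factor 1 - q powr (\<gamma> + \<xi> + 1) is multiplied into the parenthesis and cancelled
   against the same factor of q_bracket (q powr (\<gamma> + \<xi> + 2)) q 2, so that the value is also
   the intended one when \<gamma> + \<xi> = -1; mu3_1_uncancelled gives the form with the factor in front. *)
definition mu3 :: "real \<Rightarrow> real \<Rightarrow> real \<Rightarrow> real \<Rightarrow> nat \<Rightarrow> real" where
  "mu3 \<gamma> \<xi> c q n =
    (if n = 0 then
       - ((1 - q powr (\<gamma> + 1)) * (1 - q powr (c + 1)) * q_bracket (q powr (\<gamma> + \<xi> + 1)) q 2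
          + (1 - q powr \<gamma>) * (1 - q powr c) * q_bracket (q powr (\<gamma> + \<xi> + 2)) q 2
          - (1 - q powr \<gamma>) * (1 - q powr c) * q_bracket (q powr (\<gamma> + \<xi> + 2)) q 2)
     else if n = 1 then
       - (1 - q powr (\<gamma> + \<xi> + 3)) *
         (q * (1 - q powr (\<gamma> + 1)) * (1 - q powr (c + 1)) * (1 - q powr (\<gamma> + \<xi>))
              * (1 - q powr (\<gamma> + \<xi> + 4)) / (1 - q powr (\<gamma> + \<xi> + 2))
          + (1 - q powr (\<gamma> + \<xi> + 1)) *
            ((1 + q) * (1 - q powr (\<gamma> + 2)) * (1 - q powr (c + 2))
             - (1 + q) * (1 - q powr (\<gamma> + 1)) * (1 - q powr (c + 1)) * (1 - q powr (\<gamma> + \<xi> + 4))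
               / (1 - q powr (\<gamma> + \<xi> + 2))))
     else
       - (1 - q powr (2 * real n + \<gamma> + \<xi> + 1)) * (1 - q powr (real n + \<gamma> + \<xi>)) *
         ((1 - q ^ (n + 1)) * (1 - q powr (\<gamma> + real n + 1)) * (1 - q powr (c + real n + 1)) / (1 - q)
          + q ^ n * (1 - q powr (real n + \<gamma> + \<xi> - 1)) * (1 - q powr (\<gamma> + real n))
              * (1 - q powr (c + real n)) * (1 - q powr (2 * real n + \<gamma> + \<xi> + 2))
            / q_bracket (q powr (2 * real n + \<gamma> + \<xi>)) q 2
          - (1 - q powr (\<gamma> + real n)) * (1 - q powr (c + real n))
              * (1 - q powr (2 * real n + \<gamma> + \<xi> + 2)) * (1 - q ^ (n + 1))
            / ((1 - q) * (1 - q powr (2 * real n + \<gamma> + \<xi>)))))"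

lemma mu3_1_uncancelled:
  assumes "0 < q" "q < 1" "\<gamma> + \<xi> \<noteq> -1"
  shows "mu3 \<gamma> \<xi> c q 1 =
    - (1 - q powr (\<gamma> + \<xi> + 1)) * (1 - q powr (\<gamma> + \<xi> + 3)) *
      (q * (1 - q powr (\<gamma> + 1)) * (1 - q powr (c + 1)) * (1 - q powr (\<gamma> + \<xi>))
           * (1 - q powr (\<gamma> + \<xi> + 4)) / q_bracket (q powr (\<gamma> + \<xi> + 2)) q 2
       + (1 + q) * (1 - q powr (\<gamma> + 2)) * (1 - q powr (c + 2))
       - (1 + q) * (1 - q powr (\<gamma> + 1)) * (1 - q powr (c + 1)) * (1 - q powr (\<gamma> + \<xi> + 4))
         / (1 - q powr (\<gamma> + \<xi> + 2)))"
proof -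
  define u where "u = 1 - q powr (\<gamma> + \<xi> + 1)"
  have "u \<noteq> 0"
    using assms by (auto simp: u_def powr_eq_one_iff_gen)
  have "q powr (\<gamma> + \<xi> + 2) * inverse q = q powr (\<gamma> + \<xi> + 1)"
    using assms(1) powr_add[of q "\<gamma> + \<xi> + 1" 1] by (simp add: field_simps)
  then have b: "q_bracket (q powr (\<gamma> + \<xi> + 2)) q 2 = (1 - q powr (\<gamma> + \<xi> + 2)) * u"
    by (simp add: q_bracket_2 u_def)
  have aux: "- r * (X / s + u * (Y - Z)) = - u * r * (X / (s * u) + Y - Z)" for r s X Y Z :: real
    using \<open>u \<noteq> 0\<close> by (cases "s = 0") (simp_all add: field_simps)
  show ?thesis
    unfolding mu3_def b u_def[symmetric] by (simp only: aux) simp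
qed

definition mu2 :: "real \<Rightarrow> real \<Rightarrow> real \<Rightarrow> real \<Rightarrow> nat \<Rightarrow> real" where
  "mu2 \<gamma> \<xi> c q n =
    (if n = 0 then 0
     else if n = 1 then
       q * (1 - q powr (\<gamma> + 1)) * (1 - q powr (c + 1)) * (1 - q powr (\<gamma> + \<xi>))
           * q_bracket (q powr (\<gamma> + \<xi> + 4)) q 2 / (1 - q powr (\<gamma> + \<xi> + 2))
       + q * (1 - q powr \<gamma>) * (1 - q powr c) * q_bracket (q powr (\<gamma> + \<xi> + 4)) q 2
       - q * (1 - q powr \<gamma>) * (1 - q powr c) * q_bracket (q powr (\<gamma> + \<xi> + 4)) q 2
       - q * (1 - q powr (\<gamma> + 2)) * (1 - q powr (c + 2)) * q_bracket (q powr (\<gamma> + \<xi> + 2)) q 2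
       + (1 + q) * (1 - q powr (\<gamma> + 2)) * (1 - q powr (c + 2))
           * (1 - q powr (\<gamma> + \<xi> + 1)) * (1 - q powr (\<gamma> + \<xi> + 3))
       - (1 + q) * (1 - q powr (\<gamma> + 1)) * (1 - q powr (c + 1)) * (1 - q powr (\<gamma> + \<xi> + 1))
           * q_bracket (q powr (\<gamma> + \<xi> + 4)) q 2 / (1 - q powr (\<gamma> + \<xi> + 2))
     else
       (1 - q powr (2 * real n + \<gamma> + \<xi> - 1)) * q_bracket (q ^ (n + 1)) q 2
           * (1 - q powr (\<gamma> + real n + 1)) * (1 - q powr (c + real n + 1))
           * (1 - q powr (2 * real n + \<gamma> + \<xi> + 1))
         / (q powr (real n - 1) * (1 - q) ^ 2)
       + q * (1 - q powr (real n + \<gamma> + \<xi> - 1)) * (1 - q powr (\<gamma> + real n))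
           * (1 - q powr (c + real n)) * (1 - q ^ n)
           * q_bracket (q powr (2 * real n + \<gamma> + \<xi> + 2)) q 2
         / ((1 - q) * (1 - q powr (2 * real n + \<gamma> + \<xi>)))
       - (1 - q powr (2 * real n + \<gamma> + \<xi> - 1)) * (1 - q powr (\<gamma> + real n))
           * (1 - q powr (c + real n)) * q_bracket (q ^ (n + 1)) q 2
           * q_bracket (q powr (2 * real n + \<gamma> + \<xi> + 2)) q 2
         / (q powr (real n - 1) * (1 - q) ^ 2 * (1 - q powr (2 * real n + \<gamma> + \<xi>)))
       - q_bracket (q powr (2 * real n + \<gamma> + \<xi>)) q 2 * (1 - q powr (\<gamma> + real n + 1))
           * (1 - q powr (c + real n + 1)) * q_bracket (q ^ (n + 1)) q 2
         / (q powr (real n - 2) * q_bracket (q ^ 2) q 2)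
       - q * (1 - q powr (real n + \<gamma> + \<xi> - 1)) * (1 - q powr (\<gamma> + real n - 1))
           * (1 - q powr (c + real n - 1)) * (1 - q ^ n)
           * q_bracket (q powr (2 * real n + \<gamma> + \<xi> + 2)) q 2
         / ((1 - q) * (1 - q powr (2 * real n + \<gamma> + \<xi> - 2)))
       + q_bracket (q powr (2 * real n + \<gamma> + \<xi> + 2)) q 2 * (1 - q powr (\<gamma> + real n - 1))
           * (1 - q powr (c + real n - 1)) * q_bracket (q ^ (n + 1)) q 2
         / (q powr (real n - 2) * q_bracket (q ^ 2) q 2))"

definition mu1 :: "real \<Rightarrow> real \<Rightarrow> real \<Rightarrow> real \<Rightarrow> nat \<Rightarrow> real" where
  "mu1 \<gamma> \<xi> c q n = - mu2 \<gamma> \<xi> c q n - mu3 \<gamma> \<xi> c q n - mu4 \<gamma> \<xi> c q n"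

end

theory Submission
  imports Defs "HOL-Computational_Algebra.Polynomial"
begin

text \<open>
  The recurrence is proved coefficient by coefficient in \<open>z\<close>. Write \<open>N = q ^ n\<close>,
  \<open>s = q powr (\<gamma> + \<xi>)\<close>, \<open>d = s * N\<close>, \<open>t = q ^ k\<close>, and
  \<open>h x = (1 - g * x) * (1 - C * x)\<close> with \<open>g = q powr \<gamma>\<close>, \<open>C = q powr c\<close>. The coefficient of
  \<open>z ^ (k + 1)\<close> in the recurrence combines the products
  \<open>(q powr - m; q)_i * (d q^(m - n + 1); q)_i\<close> for \<open>m = n - 2, ..., n + 1\<close> and \<open>i = k + 1\<close>,
  together with those for \<open>m = n - 1, n\<close> and \<open>i = k\<close>; the latter two are multiplied by \<open>h (q * t)\<close>
  because the denominators \<open>(g q; q)_i (C q; q)_i\<close> grow by this factor when \<open>i\<close> increases.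
  For \<open>n \<ge> 2\<close> all six products have a common factor, and what remains of each of them is a polynomial
  in \<open>t\<close> (lemma \<open>q_poch_three_shifts\<close>). The whole coefficient thereby becomes a common factor times
  a polynomial in \<open>t\<close> of degree at most three, the \<open>reduced_residual\<close>.

  A cubic that vanishes at four points is zero. The points are \<open>t = N, N / q, N / q\<^sup>2, 1 / q\<close>, which
  stand for the powers \<open>z ^ (n + 1), z ^ n, z ^ (n - 1), z ^ 0\<close>. At these points most terms drop out, and the
  conditions are triangular in the coefficients: the first one relates \<open>mu4\<close> to \<open>mu6\<close>, the second brings in
  \<open>mu3\<close> and \<open>mu5\<close>, the third \<open>mu2\<close>, and in the last one the terms with \<open>mu5\<close> and \<open>mu6\<close>
  cancel, so that it says \<open>mu1 + mu2 + mu3 + mu4 = 0\<close>, the definition of \<open>mu1\<close>. In the first three conditions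
  the parameters \<open>\<gamma>\<close> and \<open>c\<close>, once \<open>d\<close> is fixed, enter only through the three values \<open>h (q * N)\<close>, \<open>h N\<close>, \<open>h (N / q)\<close>, linearly, so that each
  condition splits into short rational identities (lemma \<open>reduced_residual_roots\<close>).

  For \<open>n = 0\<close> and \<open>n = 1\<close> the common factor would involve a division by \<open>1 - q powr (1 - n)\<close> or
  \<open>1 - q powr (- n)\<close>, one of which vanishes; there are at most three powers of \<open>z\<close>, and they are compared directly.
\<close>

section \<open>Shifted q-Pochhammer symbols\<close>

lemma q_poch_0: "q_poch b q 0 = 1"
  by (simp add: q_poch_def)

lemma q_poch_Suc: "q_poch b q (Suc k) = q_poch b q k * (1 - b * q ^ k)"
  by (simp add: q_poch_def)

lemma q_poch_Suc_shift: "q_poch b q (Suc k) = (1 - b) * q_poch (b * q) q k"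
  by (simp add: q_poch_def prod.lessThan_Suc_shift mult.assoc del: prod.lessThan_Suc)

text \<open>
  The symbols for \<open>b\<close>, \<open>b * q\<close>, \<open>b * q * q\<close> share the factors from \<open>1 - b q^2\<close> to \<open>1 - b q^(k-1)\<close>,
  whose product is \<open>K\<close>. Dividing by the first two factors, instead of taking that product literally, makes
  the formulas hold for \<open>k = 0\<close> and \<open>k = 1\<close> as well, so that small exponents of \<open>z\<close> need no separate
  treatment.
\<close>

lemma q_poch_three_shifts:
  fixes b q :: real
  assumes "b \<noteq> 1" "b * q \<noteq> 1"
  obtains K where "q_poch b q k = K * (1 - b) * (1 - b * q)"
    and "q_poch (b * q) q k = K * (1 - b * q) * (1 - b * q ^ k)"
    and "q_poch (b * q * q) q k = K * (1 - b * q ^ k) * (1 - b * q * q ^ k)"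
proof -
  define K where "K = q_poch b q k / ((1 - b) * (1 - b * q))"
  have 1: "q_poch b q k = K * (1 - b) * (1 - b * q)"
    using assms by (simp add: K_def)
  have "(1 - b) * q_poch (b * q) q k = q_poch b q k * (1 - b * q ^ k)"
    by (metis q_poch_Suc q_poch_Suc_shift)
  then have "(1 - b) * q_poch (b * q) q k = (1 - b) * (K * (1 - b * q) * (1 - b * q ^ k))"
    by (simp only: 1 ac_simps)
  then have 2: "q_poch (b * q) q k = K * (1 - b * q) * (1 - b * q ^ k)"
    using assms by (metis mult_left_cancel right_minus_eq)
  have "(1 - b * q) * q_poch (b * q * q) q k = q_poch (b * q) q k * (1 - b * q * q ^ k)"
    by (metis q_poch_Suc q_poch_Suc_shift)
  then have "(1 - b * q) * q_poch (b * q * q) q k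
      = (1 - b * q) * (K * (1 - b * q ^ k) * (1 - b * q * q ^ k))"
    by (simp only: 2 ac_simps)
  then have "q_poch (b * q * q) q k = K * (1 - b * q ^ k) * (1 - b * q * q ^ k)"
    using assms by (metis mult_left_cancel right_minus_eq)
  with 1 2 show ?thesis by (rule that)
qed

section \<open>The cubic that governs one coefficient\<close>

text \<open>
  The coefficient of \<open>z ^ (k + 1)\<close> in the recurrence, as a function of \<open>t = q ^ k\<close> and with the factor common
  to all six terms removed; each group of factors in \<open>N\<close> comes from \<open>(q powr - m; q)_i\<close>, each group in
  \<open>d\<close> from \<open>(q powr (m + \<gamma> + \<xi> + 1); q)_i\<close>.
\<close>

definition reduced_residual ::
  "real \<Rightarrow> real \<Rightarrow> real \<Rightarrow> real \<Rightarrow> real \<Rightarrow> real \<Rightarrow> real \<Rightarrow> real \<Rightarrow> real \<Rightarrow> real \<Rightarrow> real \<Rightarrow> real \<Rightarrow> real" where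
  "reduced_residual q N d g c m1 m2 m3 m4 m5 m6 t =
      q * (m1 * ((1 - t / N) * (1 - q * t / N) * (1 - q * q * t / N) * ((1 - d / q) * (1 - d) * (1 - d * q)))
         + m2 * ((1 - q / N) * (1 - t / N) * (1 - q * t / N) * ((1 - d) * (1 - d * q) * (1 - d * t)))
         + m3 * ((1 - 1 / N) * (1 - q / N) * (1 - t / N) * ((1 - d * q) * (1 - d * t) * (1 - d * q * t)))
         + m4 * ((1 - 1 / (q * N)) * (1 - 1 / N) * (1 - q / N)
                 * ((1 - d * t) * (1 - d * q * t) * (1 - d * q * q * t))))
      + (1 - g * (q * t)) * (1 - c * (q * t))
         * (m5 * ((1 - q / N) * (1 - t / N) * ((1 - d) * (1 - d * q)))
          + m6 * ((1 - 1 / N) * (1 - q / N) * ((1 - d * q) * (1 - d * t))))"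

lemma reduced_residual_eq_0_of_four_roots:
  fixes q N d g c m1 m2 m3 m4 m5 m6 :: real
  defines "R \<equiv> reduced_residual q N d g c m1 m2 m3 m4 m5 m6"
  assumes q: "0 < q" "q < 1" and N: "0 < N" "N < q"
    and roots: "R N = 0" "R (N / q) = 0" "R (N / (q * q)) = 0" "R (1 / q) = 0"
  shows "R t = 0"
proof -
  define p where "p =
      smult q (smult m1 ([:1, - 1 / N:] * [:1, - q / N:] * [:1, - (q * q) / N:]
                * [:(1 - d / q) * (1 - d) * (1 - d * q):])
         + smult m2 ([:1 - q / N:] * [:1, - 1 / N:] * [:1, - q / N:] * ([:(1 - d) * (1 - d * q):] * [:1, - d:]))
         + smult m3 ([:(1 - 1 / N) * (1 - q / N):] * [:1, - 1 / N:] * ([:1 - d * q:] * [:1, - d:] * [:1, - d * q:]))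
         + smult m4 ([:(1 - 1 / (q * N)) * (1 - 1 / N) * (1 - q / N):]
                 * ([:1, - d:] * [:1, - d * q:] * [:1, - d * q * q:])))
      + [:1, - g * q:] * [:1, - c * q:] *
         (smult m5 ([:1 - q / N:] * [:1, - 1 / N:] * [:(1 - d) * (1 - d * q):])
           + smult m6 ([:(1 - 1 / N) * (1 - q / N):] * ([:1 - d * q:] * [:1, - d:])))"
  have fac: "poly [:1, - a / N:] x = 1 - a * x / N" "poly [:1, - a:] x = 1 - a * x" 
     "poly [:1, - a * b:] x = 1 - a * b * x"  "poly [:1, - a * b * q:] x = 1 - a * b * q * x" for a b x
    by (simp_all add: mult.commute)
  have R: "R x = poly p x" for x
    unfolding R_def reduced_residual_def p_def poly_add poly_mult poly_smult fac
    by (simp only: poly_pCons poly_0 mult_zero_right add_0_right mult.assoc mult_1_left)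
  \<comment> \<open>For \<open>N = q\<close> the points \<open>N / (q * q)\<close> and \<open>1 / q\<close> would coincide; this is where \<open>n \<ge> 2\<close> matters.\<close>
  have "N * q \<noteq> q * q" "q * q \<noteq> q" "N < 1" "q * q < 1" "N * q < 1"
    using q N mult_strict_mono[of q 1 q 1] mult_strict_mono[of N 1 q 1] by auto
  then have "N \<noteq> N / q" "N \<noteq> N / (q * q)" "N / q \<noteq> N / (q * q)"
      "N \<noteq> 1 / q" "N / q \<noteq> 1 / q" "N / (q * q) \<noteq> 1 / q"
    using q N by (simp_all add: divide_simps)
  then have card: "card {N, N / q, N / (q * q), 1 / q} = 4"
    by simp
  have "coeff p (Suc (Suc (Suc (Suc j)))) = 0" for j
    unfolding p_def by simp
  then have "coeff p i = 0" if "i > 3" for i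
    using that by (metis less_imp_Suc_add numeral_3_eq_3 add_Suc)
  then have "degree p \<le> 3"
    by (simp add: degree_le)
  then have "p = 0"
    by (intro poly_eqI_degree[where A = "{N, N / q, N / (q * q), 1 / q}"])
       (use roots card in \<open>auto simp: R\<close>)
  then show ?thesis by (simp add: R)
qed

text \<open>
  The hypotheses on \<open>m1\<close> to \<open>m6\<close> are the formulas for \<open>mu1\<close> to \<open>mu6\<close> with the powers of \<open>q\<close>
  expressed by \<open>N\<close>, \<open>d\<close> and \<open>X = d * N\<close>. \<open>G1\<close>, \<open>G0\<close>, \<open>Gm\<close>
  are the values of \<open>(1 - g * x) * (1 - c * x)\<close> at \<open>q * N\<close>, \<open>N\<close>, \<open>N / q\<close>; after substitution of one of the first
  three roots, the terms that contain the same one of these values add up to zero.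
\<close>

lemma reduced_residual_roots:
  fixes q N d g c m1 m2 m3 m4 m5 m6 :: real
  defines "X \<equiv> d * N" and "B \<equiv> (1 - q * N) * (1 - N)"
  defines "G1 \<equiv> (1 - g * (q * N)) * (1 - c * (q * N))" and "G0 \<equiv> (1 - g * N) * (1 - c * N)"
    and "Gm \<equiv> (1 - g * (N / q)) * (1 - c * (N / q))"
  assumes q: "0 < q" "q < 1" and N: "0 < N" "N < q"
    and nz: "1 - X \<noteq> 0" "1 - X / q \<noteq> 0" "1 - X / (q * q) \<noteq> 0"
    and m6: "m6 = (1 - q * q * X) * (1 - q * X) * (1 - d) * (1 - q * N)"
    and m5: "m5 = - q * (1 - N) * (1 - d / q) * ((1 - q * q * X) * (1 - q * X))"
    and m4: "m4 = N * G1 * ((1 - q * d) * (1 - d))"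
    and m3: "m3 = - (1 - q * X) * (1 - d) *
      ((1 - q * N) * G1 / (1 - q) + N * (1 - d / q) * G0 * (1 - q * q * X) / ((1 - X) * (1 - X / q))
       - G0 * (1 - q * q * X) * (1 - q * N) / ((1 - q) * (1 - X)))"
    and m2: "m2 = (1 - X / q) * B * G1 * (1 - q * X) / (N / q * (1 - q) ^ 2)
      + q * (1 - d / q) * G0 * (1 - N) * ((1 - q * q * X) * (1 - q * X)) / ((1 - q) * (1 - X))
      - (1 - X / q) * G0 * B * ((1 - q * q * X) * (1 - q * X)) / (N / q * (1 - q) ^ 2 * (1 - X))
      - ((1 - X) * (1 - X / q)) * G1 * B / (N / (q * q) * ((1 - q * q) * (1 - q)))
      - q * (1 - d / q) * Gm * (1 - N) * ((1 - q * q * X) * (1 - q * X)) / ((1 - q) * (1 - X / (q * q)))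
      + ((1 - q * q * X) * (1 - q * X)) * Gm * B / (N / (q * q) * ((1 - q * q) * (1 - q)))"
    and m1: "m1 = - m2 - m3 - m4"
  defines "R \<equiv> reduced_residual q N d g c m1 m2 m3 m4 m5 m6"
  shows "R N = 0" "R (N / q) = 0" "R (N / (q * q)) = 0" "R (1 / q) = 0"
proof -
  have ne: "q \<noteq> 0" "N \<noteq> 0" "1 - q \<noteq> 0" "1 + q \<noteq> 0" "1 - q * q \<noteq> 0"
    using q N mult_strict_mono[of q 1 q 1] by auto
  \<comment> \<open>The linear factors get names so that the algebra treats them as atoms: almost all the cancellations
      take place between whole factors, and expanding them would produce very large polynomials.\<close>
  define u0 u1 u2 where "u0 = 1 - 1 / (q * N)" and "u1 = 1 - 1 / N" and "u2 = 1 - q / N"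
  define p1 p2 where "p1 = 1 - 1 / q" and "p2 = 1 - 1 / (q * q)"
  define d0 d1 d2 where "d0 = 1 - d / q" and "d1 = 1 - d" and "d2 = 1 - d * q"
  define x0 x1 x2 y1 y2 where "x0 = 1 - X" and "x1 = 1 - q * X" and "x2 = 1 - q * q * X"
    and "y1 = 1 - X / q" and "y2 = 1 - X / (q * q)"
  note factor_defs = u0_def u1_def u2_def p1_def p2_def d0_def d1_def d2_def
    x0_def x1_def x2_def y1_def y2_def
  have m4': "m4 = N * G1 * (d2 * d1)"
    by (simp add: m4 factor_defs mult.commute)
  have m5': "m5 = - q * (1 - N) * d0 * (x2 * x1)"
    by (simp add: m5 factor_defs)
  have m6': "m6 = x2 * x1 * d1 * (1 - q * N)"
    by (simp add: m6 factor_defs)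
  \<comment> \<open>\<open>m3\<close> and \<open>m2\<close> are split according to \<open>G1\<close>, \<open>G0\<close>, \<open>Gm\<close>.\<close>
  define a1 a0 where "a1 = - x1 * d1 * (1 - q * N) / (1 - q)"
    and "a0 = - x1 * d1 * x2 * (N * d0 / (x0 * y1) - (1 - q * N) / ((1 - q) * x0))"
  have m3': "m3 = G1 * a1 + G0 * a0"
    unfolding m3 a1_def a0_def factor_defs[symmetric]
    by (simp add: algebra_simps add_divide_distrib diff_divide_distrib)
  define e1 e0 em where "e1 = y1 * B * x1 / (N / q * (1 - q) ^ 2)
        - x0 * y1 * B / (N / (q * q) * ((1 - q * q) * (1 - q)))"
    and "e0 = q * d0 * (1 - N) * (x2 * x1) / ((1 - q) * x0)
        - y1 * B * (x2 * x1) / (N / q * (1 - q) ^ 2 * x0)"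
    and "em = x2 * x1 * B / (N / (q * q) * ((1 - q * q) * (1 - q)))
        - q * d0 * (1 - N) * (x2 * x1) / ((1 - q) * y2)"
  have m2': "m2 = G1 * e1 + G0 * e0 + Gm * em"
    unfolding m2 e1_def e0_def em_def factor_defs[symmetric]
    by (simp add: ring_distribs mult.commute mult.left_commute)
  have nz': "x0 \<noteq> 0" "y1 \<noteq> 0" "y2 \<noteq> 0"
    using nz by (simp_all add: factor_defs)
  \<comment> \<open>These relate the factors in \<open>1 / N\<close>, from the Pochhammer symbols, to those in \<open>N\<close>, from \<open>m1\<close> to \<open>m6\<close>.\<close>
  have qNu0: "q * N * u0 = - (1 - q * N)"
    using ne by (simp add: factor_defs field_simps)
  have key: "q * (1 - N) * u0 = (1 - q * N) * u1"
    using ne by (simp add: factor_defs field_simps)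

  \<comment> \<open>At each root the value is written as a sum of multiples of expressions that are zero.\<close>
  show "R N = 0"
  proof -
    have "R N = q * (m4 * (u0 * u1 * u2 * (x0 * x1 * x2))) + G1 * (m6 * (u1 * u2 * (d2 * x0)))"
      using ne by (simp add: R_def reduced_residual_def factor_defs G1_def X_def ac_simps)
    also have "\<dots> = (q * N * u0 + (1 - q * N)) * (G1 * u1 * u2 * d1 * d2 * x0 * x1 * x2)"
      unfolding m4' m6' by algebra
    finally show ?thesis by (simp add: qNu0)
  qed

  show "R (N / q) = 0"
  proof -
    have 1: "a1 * p1 + N * d1 * u0 * x1 = 0"
      using ne by (simp add: a1_def factor_defs divide_simps) (simp add: algebra_simps)
    have 0: "q * a0 * u1 * p1 * x0 * y1 + m5 * p1 * d1 + m6 * u1 * y1 = 0"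
      using ne nz' by (simp add: a0_def m5' m6' u1_def p1_def divide_simps) (simp add: algebra_simps power2_eq_square)
    have "R (N / q) = q * (m4 * (u0 * u1 * u2 * (y1 * x0 * x1)) + m3 * (u1 * u2 * p1 * (d2 * y1 * x0)))
        + G0 * (m5 * (u2 * p1 * (d1 * d2)) + m6 * (u1 * u2 * (d2 * y1)))"
      using ne by (simp add: R_def reduced_residual_def factor_defs G0_def X_def ac_simps)
    also have "\<dots> = (a1 * p1 + N * d1 * u0 * x1) * (q * G1 * u1 * u2 * d2 * y1 * x0)
        + (q * a0 * u1 * p1 * x0 * y1 + m5 * p1 * d1 + m6 * u1 * y1) * (G0 * u2 * d2)"
      unfolding m3' m4' by algebra
    finally show ?thesis by (simp add: 0 1)
  qed

  show "R (N / (q * q)) = 0"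
  proof -
    have 1: "e1 * p2 * p1 * d1 + a1 * u1 * p2 * y1 + N * d1 * u0 * u1 * y1 * x0 = 0"
      using ne nz' by (simp add: e1_def a1_def B_def u0_def u1_def p1_def p2_def divide_simps) (simp add: algebra_simps power2_eq_square)
    have 0: "e0 * p1 * d1 + a0 * u1 * y1 = 0"
      using ne nz' by (simp add: e0_def a0_def B_def u1_def p1_def divide_simps) (simp add: algebra_simps power2_eq_square)
    have m: "q * em * p2 * p1 * d1 * y2 + m5 * p2 * d1 + m6 * u1 * y2 = 0"
      using ne nz' by (simp add: em_def m5' m6' B_def u1_def p1_def p2_def divide_simps) (simp add: algebra_simps power2_eq_square)
    have "R (N / (q * q)) = q * (m4 * (u0 * u1 * u2 * (y2 * y1 * x0)) + m3 * (u1 * u2 * p2 * (d2 * y2 * y1))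
          + m2 * (u2 * p2 * p1 * (d1 * d2 * y2)))
        + Gm * (m5 * (u2 * p2 * (d1 * d2)) + m6 * (u1 * u2 * (d2 * y2)))"
      using ne by (simp add: R_def reduced_residual_def factor_defs Gm_def X_def ac_simps)
    also have "\<dots> = (e1 * p2 * p1 * d1 + a1 * u1 * p2 * y1 + N * d1 * u0 * u1 * y1 * x0) * (q * G1 * u2 * d2 * y2)
        + (e0 * p1 * d1 + a0 * u1 * y1) * (q * G0 * u2 * d2 * p2 * y2)
        + (q * em * p2 * p1 * d1 * y2 + m5 * p2 * d1 + m6 * u1 * y2) * (Gm * u2 * d2)"
      unfolding m2' m3' m4' by algebra
    finally show ?thesis using 0 1 m by simp
  qed

  show "R (1 / q) = 0"
  proof -
    have t: "1 / q / N = 1 / (q * N)" "q * (1 / q) = 1" "q * q * (1 / q) = q"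
      "d * (1 / q) = d / q" "d * q * (1 / q) = d" "d * q * q * (1 / q) = d * q"
      using ne by simp_all
    have "R (1 / q) = q * ((m1 + m2 + m3 + m4) * (u0 * u1 * u2 * (d0 * d1 * d2)))
        + (1 - g) * (1 - c) * (m5 * (u2 * u0 * (d1 * d2)) + m6 * (u1 * u2 * (d2 * d0)))"
      unfolding R_def reduced_residual_def t mult_1_right factor_defs[symmetric] by algebra
    also have "\<dots> = ((1 - q * N) * u1 - q * (1 - N) * u0) * ((1 - g) * (1 - c) * u2 * d0 * d1 * d2 * x1 * x2)"
      unfolding m1 m5' m6' by algebra
    finally show ?thesis by (simp add: key)
  qed
qed


section \<open>Comparison of coefficients\<close>

definition jacobi_coeff :: "real \<Rightarrow> real \<Rightarrow> real \<Rightarrow> real \<Rightarrow> nat \<Rightarrow> nat \<Rightarrow> real" where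
  "jacobi_coeff \<gamma> \<xi> c q m i =
     q_poch (q powr (- real m)) q i * q_poch (q powr (real m + \<gamma> + \<xi> + 1)) q i /
       (q_poch (q powr (\<gamma> + 1)) q i * q_poch (q powr (c + 1)) q i) * q ^ i"

lemma jacobi_coeff_0 [simp]: "jacobi_coeff \<gamma> \<xi> c q m 0 = 1"
  by (simp add: jacobi_coeff_def q_poch_0)

lemma jacobi_coeff_eq_0: "0 < q \<Longrightarrow> m < i \<Longrightarrow> jacobi_coeff \<gamma> \<xi> c q m i = 0"
  by (simp add: jacobi_coeff_def q_poch_terminates)

lemma gen_little_q_jacobi_eq_sum_coeff:
  assumes "0 < q" "q < 1" "m \<le> M"
  shows "gen_little_q_jacobi \<gamma> \<xi> c q m z = (\<Sum>i\<le>M. of_real (jacobi_coeff \<gamma> \<xi> c q m i) * z ^ i)"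
proof -
  have "gen_little_q_jacobi \<gamma> \<xi> c q m z = (\<Sum>i\<le>m. of_real (jacobi_coeff \<gamma> \<xi> c q m i) * z ^ i)"
    unfolding gen_little_q_jacobi_eq_sum[OF assms(1,2)] jacobi_coeff_def
    by (simp add: power_mult_distrib mult.assoc)
  also have "\<dots> = (\<Sum>i\<le>M. of_real (jacobi_coeff \<gamma> \<xi> c q m i) * z ^ i)"
    using assms by (intro sum.mono_neutral_left) (auto simp: jacobi_coeff_eq_0)
  finally show ?thesis .
qed

text \<open>
  The sums run up to \<open>n + 1\<close> for all four polynomials, as the higher coefficients are zero anyway. The
  assumption \<open>top\<close> lets the multiplication by \<open>z\<close> be absorbed into an index shift without a remainder.
\<close>

lemma four_term_relation_of_coeffs:
  fixes a1 a2 a3 a4 :: "nat \<Rightarrow> real" and m1 m2 m3 m4 m5 m6 :: real and z :: complex and n :: nat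
  defines "S \<equiv> \<lambda>a. \<Sum>i\<le>Suc n. of_real (a i) * z ^ i"
  assumes const: "m1 * a1 0 + m2 * a2 0 + m3 * a3 0 + m4 * a4 0 = 0"
    and step: "\<And>k. k \<le> n \<Longrightarrow> m1 * a1 (Suc k) + m2 * a2 (Suc k) + m3 * a3 (Suc k) + m4 * a4 (Suc k)
        + m5 * a2 k + m6 * a3 k = 0"
    and top: "a2 (Suc n) = 0" "a3 (Suc n) = 0"
  shows "of_real m1 * S a1 + (of_real m2 + z * of_real m5) * S a2
      + (of_real m3 + z * of_real m6) * S a3 + of_real m4 * S a4 = 0"
proof -
  define F where "F = (\<lambda>i. m1 * a1 i + m2 * a2 i + m3 * a3 i + m4 * a4 i)"
  define H where "H = (\<lambda>i. m5 * a2 i + m6 * a3 i)"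
  have lin: "S (\<lambda>i. x * a i + y * b i) = of_real x * S a + of_real y * S b" for x y a b
    unfolding S_def by (simp only: sum.distrib sum_distrib_left distrib_right mult.assoc of_real_add of_real_mult)
  have FS: "S F = of_real m1 * S a1 + of_real m2 * S a2 + of_real m3 * S a3 + of_real m4 * S a4"
    unfolding F_def S_def by (simp only: sum.distrib sum_distrib_left distrib_right mult.assoc of_real_add of_real_mult)
  have HS: "S H = of_real m5 * S a2 + of_real m6 * S a3"
    unfolding H_def by (rule lin)
  have "S F = (\<Sum>k\<le>n. of_real (F (Suc k)) * z ^ Suc k)"
    unfolding S_def sum.atMost_Suc_shift using const by (simp add: F_def)
  moreover have "z * S H = (\<Sum>k\<le>n. of_real (H k) * z ^ Suc k)"
    unfolding S_def using top by (simp add: H_def sum_distrib_left mult_ac)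
  ultimately have "S F + z * S H = (\<Sum>k\<le>n. of_real (F (Suc k) + H k) * z ^ Suc k)"
    by (simp only: sum.distrib[symmetric] distrib_right of_real_add)
  also have "\<dots> = 0"
    using step by (intro sum.neutral) (simp add: F_def H_def add.assoc)
  finally show ?thesis
    unfolding FS HS by (simp add: algebra_simps)
qed

lemma q_poch_powr_nonzero:
  assumes "0 < q" "q < 1" "0 < a"
  shows "q_poch (q powr a) q k \<noteq> (0 :: real)"
proof -
  have "q powr a * q ^ j < 1" for j
    using assms powr01_less_one[of q "a + real j"] by (simp add: powr_add powr_realpow)
  then show ?thesis
    unfolding q_poch_def by (simp add: less_imp_neq)
qed

text \<open>
  The bridge to the cubic: for \<open>n \<ge> 2\<close> neither \<open>1 - q powr (- n)\<close> nor \<open>1 - q powr (1 - n)\<close> is zero, and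
  \<open>\<gamma> + \<xi> > -2\<close> keeps \<open>d\<close> and \<open>d * q\<close> below one; so the common factor may be extracted from both families of
  Pochhammer symbols, with \<open>b = 1 / N\<close> and with \<open>b = d\<close>.
\<close>

lemma coeff_relation_ge_2:
  fixes q \<gamma> \<xi> c :: real
  assumes q: "0 < q" "q < 1" and par: "\<gamma> > -1" "\<xi> > -1" "c > -1" and n: "2 \<le> n"
  defines "a \<equiv> jacobi_coeff \<gamma> \<xi> c q"
  shows "mu1 \<gamma> \<xi> c q n * a (n - 2) (Suc k) + mu2 \<gamma> \<xi> c q n * a (n - 1) (Suc k)
      + mu3 \<gamma> \<xi> c q n * a n (Suc k) + mu4 \<gamma> \<xi> c q n * a (n + 1) (Suc k)
      + mu5 \<gamma> \<xi> c q n * a (n - 1) k + mu6 \<gamma> \<xi> c q n * a n k = 0"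
proof -
  define N where "N = q ^ n"
  define g C s d where "g = q powr \<gamma>" and "C = q powr c" and "s = q powr (\<gamma> + \<xi>)" and "d = s * N"
  define m1 m2 m3 m4 m5 m6 where "m1 = mu1 \<gamma> \<xi> c q n" and "m2 = mu2 \<gamma> \<xi> c q n" and "m3 = mu3 \<gamma> \<xi> c q n"
    and "m4 = mu4 \<gamma> \<xi> c q n" and "m5 = mu5 \<gamma> \<xi> c q n" and "m6 = mu6 \<gamma> \<xi> c q n"
  note m_defs = m1_def m2_def m3_def m4_def m5_def m6_def
  have Npow: "q powr real n = N"
    using q by (simp add: N_def powr_realpow)
  have s_split: "q powr \<gamma> * q powr \<xi> = s"
    by (simp add: s_def powr_add)
  have N2: "q powr (2 * real n) = N * N"
    by (simp add: Npow[symmetric] powr_add[symmetric])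
  have q2: "q powr 2 = q * q" and q1: "q powr 1 = q"
    using q by (simp_all add: power2_eq_square)
  have N: "0 < N" "N < q"
    using q n power_strict_decreasing[of 1 n q] by (simp_all add: N_def)
  have N2': "q powr (real n * 2) = N * N"
    using N2 by (simp add: mult.commute)
  note expand = powr_add powr_diff Npow N2 N2' q2 q1
  have X: "q powr (2 * real n + \<gamma> + \<xi> + 2) = q * q * (d * N)"
    "q powr (2 * real n + \<gamma> + \<xi> + 1) = q * (d * N)"
    "q powr (2 * real n + \<gamma> + \<xi>) = d * N"
    "q powr (2 * real n + \<gamma> + \<xi> - 1) = d * N / q"
    "q powr (2 * real n + \<gamma> + \<xi> - 2) = d * N / (q * q)"
    using q by (simp_all add: expand d_def s_split[symmetric] mult_ac)
  have D: "q powr (real n + \<gamma> + \<xi> + 1) = d * q"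
    "q powr (real n + \<gamma> + \<xi>) = d"
    "q powr (real n + \<gamma> + \<xi> - 1) = d / q"
    using q by (simp_all add: expand d_def s_split[symmetric] mult_ac)
  have G: "q powr (\<gamma> + real n + 1) = g * (q * N)" "q powr (c + real n + 1) = C * (q * N)"
    "q powr (\<gamma> + real n) = g * N" "q powr (c + real n) = C * N"
    "q powr (\<gamma> + real n - 1) = g * (N / q)" "q powr (c + real n - 1) = C * (N / q)"
    using q by (simp_all add: expand g_def C_def)
  have M: "q powr (real n - 1) = N / q" "q powr (real n - 2) = N / (q * q)" "q ^ (n + 1) = q * N" "q ^ n = N"
    using q by (simp_all add: expand N_def)
  have br: "q_bracket (q * q * (d * N)) q 2 = (1 - q * q * (d * N)) * (1 - q * (d * N))"
    "q_bracket (d * N) q 2 = (1 - d * N) * (1 - d * N / q)"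
    "q_bracket (q * N) q 2 = (1 - q * N) * (1 - N)"
    "q_bracket (q ^ 2) q 2 = (1 - q * q) * (1 - q)"
    "q_bracket (d * q) q 2 = (1 - q * d) * (1 - d)"
    using q by (simp_all add: q_bracket_2 power2_eq_square field_simps)
  have lt1: "d < 1" "d * q < 1" "d * N < 1" "d * N / q < 1" "d * N / (q * q) < 1"
  proof -
    have "q powr (real n + \<gamma> + \<xi>) < 1" "q powr (real n + \<gamma> + \<xi> + 1) < 1"
      "q powr (2 * real n + \<gamma> + \<xi>) < 1" "q powr (2 * real n + \<gamma> + \<xi> - 1) < 1"
      "q powr (2 * real n + \<gamma> + \<xi> - 2) < 1"
      using q par n by (simp_all add: powr01_less_one)
    then show "d < 1" "d * q < 1" "d * N < 1" "d * N / q < 1" "d * N / (q * q) < 1"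
      unfolding X D .
  qed
  have roots: "reduced_residual q N d g C m1 m2 m3 m4 m5 m6 N = 0"
    "reduced_residual q N d g C m1 m2 m3 m4 m5 m6 (N / q) = 0"
    "reduced_residual q N d g C m1 m2 m3 m4 m5 m6 (N / (q * q)) = 0"
    "reduced_residual q N d g C m1 m2 m3 m4 m5 m6 (1 / q) = 0"
  proof -
    have e6: "m6 = (1 - q * q * (d * N)) * (1 - q * (d * N)) * (1 - d) * (1 - q * N)"
      unfolding m6_def mu6_def X D M br by simp
    have e5: "m5 = - q * (1 - N) * (1 - d / q) * ((1 - q * q * (d * N)) * (1 - q * (d * N)))"
      unfolding m5_def mu5_def X D M br by simp
    have e4: "m4 = N * ((1 - g * (q * N)) * (1 - C * (q * N))) * ((1 - q * d) * (1 - d))"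
      unfolding m4_def mu4_def X D G M br by simp
    have e1: "m1 = - m2 - m3 - m4"
      by (simp add: m_defs mu1_def)
    have nz: "1 - d * N \<noteq> 0" "1 - d * N / q \<noteq> 0" "1 - d * N / (q * q) \<noteq> 0"
      using lt1 by linarith+
    have if_n: "(if n = 0 then u else if n = 1 then v else w) = w" for u v w :: real
      using n by simp
    have e3: "m3 = - (1 - q * (d * N)) * (1 - d) *
      ((1 - q * N) * ((1 - g * (q * N)) * (1 - C * (q * N))) / (1 - q)
       + N * (1 - d / q) * ((1 - g * N) * (1 - C * N)) * (1 - q * q * (d * N)) / ((1 - d * N) * (1 - d * N / q))
       - ((1 - g * N) * (1 - C * N)) * (1 - q * q * (d * N)) * (1 - q * N) / ((1 - q) * (1 - d * N)))"
      unfolding m3_def mu3_def if_n X D G M br by (simp only: mult.assoc)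
    note e2 = m2_def[unfolded mu2_def if_n X D G M br]
    show "reduced_residual q N d g C m1 m2 m3 m4 m5 m6 N = 0"
      "reduced_residual q N d g C m1 m2 m3 m4 m5 m6 (N / q) = 0"
      "reduced_residual q N d g C m1 m2 m3 m4 m5 m6 (N / (q * q)) = 0"
      "reduced_residual q N d g C m1 m2 m3 m4 m5 m6 (1 / q) = 0"
      by (rule reduced_residual_roots[OF q N nz e6 e5 e4 e3 _ e1]; simp only: e2 mult.assoc)+
  qed
  \<comment> \<open>\<open>K\<close> and \<open>L\<close> are the factors shared by the symbols with base \<open>q powr - m\<close> and
      \<open>q powr (m + \<gamma> + \<xi> + 1)\<close>.\<close>
  define t e where "t = q ^ k" and "e = 1 / N"
  have R0: "reduced_residual q N d g C m1 m2 m3 m4 m5 m6 t = 0"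
    by (rule reduced_residual_eq_0_of_four_roots[OF q N roots])
  have "e \<noteq> 1" "e * q \<noteq> 1"
    using q N by (auto simp: e_def)
  then obtain K where K: "q_poch e q k = K * (1 - e) * (1 - e * q)"
    "q_poch (e * q) q k = K * (1 - e * q) * (1 - e * t)"
    "q_poch (e * q * q) q k = K * (1 - e * t) * (1 - e * q * t)"
    unfolding t_def by (rule q_poch_three_shifts)
  have "d \<noteq> 1" "d * q \<noteq> 1"
    using lt1 by auto
  then obtain L where L: "q_poch d q k = L * (1 - d) * (1 - d * q)"
    "q_poch (d * q) q k = L * (1 - d * q) * (1 - d * t)"
    "q_poch (d * q * q) q k = L * (1 - d * t) * (1 - d * q * t)"
    unfolding t_def by (rule q_poch_three_shifts)
  have Suc_t: "q_poch b q (Suc k) = q_poch b q k * (1 - b * t)" for b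
    by (simp add: q_poch_Suc t_def)
  have Suc_e: "q_poch (e / q) q (Suc k) = (1 - e / q) * q_poch e q k"
    and Suc_d: "q_poch (d / q) q (Suc k) = (1 - d / q) * q_poch d q k"
    using q by (simp_all add: q_poch_Suc_shift)
  \<comment> \<open>All six coefficients are brought over the denominator that belongs to the index \<open>k + 1\<close>, which costs a
      factor \<open>h\<close> in those with index \<open>k\<close>.\<close>
  define den where "den = q_poch (g * q) q (Suc k) * q_poch (C * q) q (Suc k)"
  define h where "h = (1 - g * (q * t)) * (1 - C * (q * t))"
  have gq: "g * q = q powr (\<gamma> + 1)" and Cq: "C * q = q powr (c + 1)"
    using q by (simp_all add: g_def C_def powr_add)
  have nzden: "q_poch (g * q) q j \<noteq> 0" "q_poch (C * q) q j \<noteq> 0" for j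
    unfolding gq Cq by (rule q_poch_powr_nonzero[OF q], use par in simp)+
  have den: "den = q_poch (g * q) q k * q_poch (C * q) q k * h"
    unfolding den_def h_def Suc_t by (simp add: mult_ac)
  have aSuc: "a m (Suc k) = q * t / den *
      (q_poch (q powr (- real m)) q (Suc k) * q_poch (q powr (real m + \<gamma> + \<xi> + 1)) q (Suc k))" for m
    unfolding a_def jacobi_coeff_def den_def gq Cq t_def by simp
  have h0: "h \<noteq> 0"
    using nzden[of "Suc k"] unfolding h_def Suc_t by (simp add: mult_ac)
  have a: "a m k = t / den * h *
      (q_poch (q powr (- real m)) q k * q_poch (q powr (real m + \<gamma> + \<xi> + 1)) q k)" for m
    unfolding a_def jacobi_coeff_def den gq[symmetric] Cq[symmetric] t_def using h0 by simp
  have E: "q powr (- real (n + 1)) = e / q" "q powr (- real n) = e"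
    "q powr (- real (n - 1)) = e * q" "q powr (- real (n - 2)) = e * q * q"
    using q n by (simp_all add: powr_minus powr_add powr_diff Npow q2 q1 e_def of_nat_diff field_simps)
  have D': "q powr (real (n + 1) + \<gamma> + \<xi> + 1) = d * q * q" "q powr (real (n - 1) + \<gamma> + \<xi> + 1) = d"
    "q powr (real (n - 2) + \<gamma> + \<xi> + 1) = d / q"
    using q n D by (simp_all add: expand of_nat_diff d_def s_split[symmetric] mult_ac)
  have "q * (m1 * (q_poch (e * q * q) q (Suc k) * q_poch (d / q) q (Suc k))
          + m2 * (q_poch (e * q) q (Suc k) * q_poch d q (Suc k))
          + m3 * (q_poch e q (Suc k) * q_poch (d * q) q (Suc k))
          + m4 * (q_poch (e / q) q (Suc k) * q_poch (d * q * q) q (Suc k)))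
      + h * (m5 * (q_poch (e * q) q k * q_poch d q k) + m6 * (q_poch e q k * q_poch (d * q) q k))
      = K * L * reduced_residual q N d g C m1 m2 m3 m4 m5 m6 t"
  proof -
    have eN: "t / N = e * t" "q * t / N = e * q * t" "q * q * t / N = e * q * q * t"
      "q / N = e * q" "1 / N = e" "1 / (q * N) = e / q"
      by (simp_all add: e_def mult_ac)
    show ?thesis
      unfolding reduced_residual_def eN h_def[symmetric] Suc_e Suc_d
        Suc_t[of "e * q * q"] Suc_t[of "e * q"] Suc_t[of e] Suc_t[of d] Suc_t[of "d * q"] Suc_t[of "d * q * q"]
        K L by algebra
  qed
  then have P0: "q * (m1 * (q_poch (e * q * q) q (Suc k) * q_poch (d / q) q (Suc k))
          + m2 * (q_poch (e * q) q (Suc k) * q_poch d q (Suc k))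
          + m3 * (q_poch e q (Suc k) * q_poch (d * q) q (Suc k))
          + m4 * (q_poch (e / q) q (Suc k) * q_poch (d * q * q) q (Suc k)))
      + h * (m5 * (q_poch (e * q) q k * q_poch d q k) + m6 * (q_poch e q k * q_poch (d * q) q k)) = 0"
    by (simp add: R0)
  have "m1 * a (n - 2) (Suc k) + m2 * a (n - 1) (Suc k) + m3 * a n (Suc k) + m4 * a (n + 1) (Suc k)
      + m5 * a (n - 1) k + m6 * a n k = t / den * (q * (m1 * (q_poch (e * q * q) q (Suc k) * q_poch (d / q) q (Suc k))
          + m2 * (q_poch (e * q) q (Suc k) * q_poch d q (Suc k))
          + m3 * (q_poch e q (Suc k) * q_poch (d * q) q (Suc k))
          + m4 * (q_poch (e / q) q (Suc k) * q_poch (d * q * q) q (Suc k)))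
      + h * (m5 * (q_poch (e * q) q k * q_poch d q k) + m6 * (q_poch e q k * q_poch (d * q) q k)))"
    unfolding aSuc a E D D' times_divide_eq_left[symmetric] by (simp add: algebra_simps)
  from this[unfolded P0 mult_zero_right] show ?thesis
    unfolding m_defs .
qed


section \<open>The cases of small degree\<close>

lemma coeffs_le_2:
  fixes q \<gamma> \<xi> c :: real
  assumes q: "0 < q"
  defines "g \<equiv> q powr \<gamma>" and "C \<equiv> q powr c" and "s \<equiv> q powr (\<gamma> + \<xi>)"
  shows "jacobi_coeff \<gamma> \<xi> c q 1 1 = (1 - 1 / q) * (1 - s * q ^ 2) / ((1 - g * q) * (1 - C * q)) * q"
    and "jacobi_coeff \<gamma> \<xi> c q 2 1 = (1 - 1 / q ^ 2) * (1 - s * q ^ 3) / ((1 - g * q) * (1 - C * q)) * q"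
    and "jacobi_coeff \<gamma> \<xi> c q 2 2 = (1 - 1 / q ^ 2) * (1 - 1 / q) * ((1 - s * q ^ 3) * (1 - s * q ^ 4))
      / (((1 - g * q) * (1 - g * q ^ 2)) * ((1 - C * q) * (1 - C * q ^ 2))) * q ^ 2"
proof -
  have base: "q powr (- real 1) = 1 / q" "q powr (- real 2) = 1 / q ^ 2"
      "q powr (real 1 + \<gamma> + \<xi> + 1) = s * q ^ 2" "q powr (real 2 + \<gamma> + \<xi> + 1) = s * q ^ 3"
      "q powr (\<gamma> + 1) = g * q" "q powr (c + 1) = C * q"
    using q by (simp_all add: powr_minus powr_add s_def g_def C_def power2_eq_square power3_eq_cube field_simps)
  have len1: "q_poch b q 1 = 1 - b" and len2: "q_poch b q 2 = (1 - b) * (1 - b * q)" for b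
    by (simp_all add: q_poch_def numeral_2_eq_2)
  have pw: "1 / q ^ 2 * q = 1 / q" "s * q ^ 3 * q = s * q ^ 4" "g * q * q = g * q ^ 2" "C * q * q = C * q ^ 2"
    using q by (simp_all add: power2_eq_square power3_eq_cube power4_eq_xxxx)
  show "jacobi_coeff \<gamma> \<xi> c q 1 1 = (1 - 1 / q) * (1 - s * q ^ 2) / ((1 - g * q) * (1 - C * q)) * q"
    unfolding jacobi_coeff_def base len1 by simp
  show "jacobi_coeff \<gamma> \<xi> c q 2 1 = (1 - 1 / q ^ 2) * (1 - s * q ^ 3) / ((1 - g * q) * (1 - C * q)) * q"
    unfolding jacobi_coeff_def base len1 by simp
  show "jacobi_coeff \<gamma> \<xi> c q 2 2 = (1 - 1 / q ^ 2) * (1 - 1 / q) * ((1 - s * q ^ 3) * (1 - s * q ^ 4))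
      / (((1 - g * q) * (1 - g * q ^ 2)) * ((1 - C * q) * (1 - C * q ^ 2))) * q ^ 2"
    unfolding jacobi_coeff_def base len2 pw by simp
qed

lemma powr_add_small_numeral:
  fixes q a :: real
  assumes "0 < q"
  shows "q powr (a + 1) = q powr a * q" "q powr (a + 2) = q powr a * q ^ 2"
    "q powr (a + 3) = q powr a * q ^ 3" "q powr (a + 4) = q powr a * q ^ 4"
  using assms by (simp_all add: powr_add)

lemma q_bracket_2_power:
  fixes q s :: real
  assumes "0 < q"
  shows "q_bracket (s * q ^ Suc j) q 2 = (1 - s * q ^ Suc j) * (1 - s * q ^ j)"
  using assms by (simp add: q_bracket_2)

lemma coeff_relations_0:
  fixes q \<gamma> \<xi> c :: real
  assumes q: "0 < q" "q < 1" and par: "\<gamma> > -1" "c > -1"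
  shows "mu3 \<gamma> \<xi> c q 0 + mu4 \<gamma> \<xi> c q 0 = 0"
    and "mu4 \<gamma> \<xi> c q 0 * jacobi_coeff \<gamma> \<xi> c q 1 1 + mu6 \<gamma> \<xi> c q 0 = 0"
proof -
  define g C s where "g = q powr \<gamma>" and "C = q powr c" and "s = q powr (\<gamma> + \<xi>)"
  define S where "S = (\<lambda>j. 1 - s * q ^ j)"
  have ne: "1 - g * q \<noteq> 0" "1 - C * q \<noteq> 0" "q \<noteq> 0"
    using q par powr01_less_one[OF q, of "\<gamma> + 1"] powr01_less_one[OF q, of "c + 1"]
    by (auto simp: g_def C_def powr_add_small_numeral)
  have br: "q_bracket (s * q) q 2 = S 1 * S 0" "q_bracket (s * q ^ 2) q 2 = S 2 * S 1"
    using q_bracket_2_power[OF q(1), of s 0] q_bracket_2_power[OF q(1), of s 1]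
    by (simp_all add: S_def numeral_2_eq_2)
  have m3: "mu3 \<gamma> \<xi> c q 0 = - ((1 - g * q) * (1 - C * q) * (S 1 * S 0))"
    using q by (simp add: mu3_def powr_add_small_numeral g_def C_def br[unfolded s_def])
  have m4: "mu4 \<gamma> \<xi> c q 0 = (1 - g * q) * (1 - C * q) * (S 1 * S 0)"
    using q by (simp add: mu4_def powr_add_small_numeral g_def C_def br[unfolded s_def])
  have m6: "mu6 \<gamma> \<xi> c q 0 = S 2 * S 1 * S 0 * (1 - q)"
    using q by (simp add: mu6_def powr_add_small_numeral br[unfolded s_def]) (simp add: S_def s_def)
  have c1: "jacobi_coeff \<gamma> \<xi> c q 1 1 = (1 - 1 / q) * S 2 / ((1 - g * q) * (1 - C * q)) * q"
    using coeffs_le_2(1)[OF q(1), of \<gamma> \<xi> c] by (simp add: g_def C_def s_def S_def)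
  show "mu3 \<gamma> \<xi> c q 0 + mu4 \<gamma> \<xi> c q 0 = 0"
    by (simp add: m3 m4)
  show "mu4 \<gamma> \<xi> c q 0 * jacobi_coeff \<gamma> \<xi> c q 1 1 + mu6 \<gamma> \<xi> c q 0 = 0"
    unfolding m4 m6 c1 using ne by (simp add: divide_simps) (simp add: algebra_simps)
qed

text \<open>
  None of the three identities uses a relation between the factors \<open>S0\<close> to \<open>S4\<close>, and only \<open>S2\<close> among
  them occurs as a denominator. The case \<open>\<gamma> + \<xi> = -1\<close>, in which \<open>S1\<close> vanishes, is therefore covered.
\<close>

lemma coeff_relations_1:
  fixes q \<gamma> \<xi> c :: real
  assumes q: "0 < q" "q < 1" and par: "\<gamma> > -1" "\<xi> > -1" "c > -1"
  shows "mu2 \<gamma> \<xi> c q 1 + mu3 \<gamma> \<xi> c q 1 + mu4 \<gamma> \<xi> c q 1 = 0"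
    and "mu3 \<gamma> \<xi> c q 1 * jacobi_coeff \<gamma> \<xi> c q 1 1 + mu4 \<gamma> \<xi> c q 1 * jacobi_coeff \<gamma> \<xi> c q 2 1
       + mu5 \<gamma> \<xi> c q 1 + mu6 \<gamma> \<xi> c q 1 = 0"
    and "mu4 \<gamma> \<xi> c q 1 * jacobi_coeff \<gamma> \<xi> c q 2 2 + mu6 \<gamma> \<xi> c q 1 * jacobi_coeff \<gamma> \<xi> c q 1 1 = 0"
proof -
  define g C s where "g = q powr \<gamma>" and "C = q powr c" and "s = q powr (\<gamma> + \<xi>)"
  define S0 S1 S2 S3 S4 where "S0 = 1 - s" and "S1 = 1 - s * q" and "S2 = 1 - s * q ^ 2"
    and "S3 = 1 - s * q ^ 3" and "S4 = 1 - s * q ^ 4"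
  note S_defs = S0_def S1_def S2_def S3_def S4_def
  define g1 g2 C1 C2 where "g1 = 1 - g * q" and "g2 = 1 - g * q ^ 2" and "C1 = 1 - C * q" and "C2 = 1 - C * q ^ 2"
  note gC_defs = g1_def g2_def C1_def C2_def
  have ne: "g1 \<noteq> 0" "g2 \<noteq> 0" "C1 \<noteq> 0" "C2 \<noteq> 0" "S2 \<noteq> 0" "q \<noteq> 0"
    using q par powr01_less_one[OF q, of "\<gamma> + 1"] powr01_less_one[OF q, of "c + 1"]
      powr01_less_one[OF q, of "\<gamma> + 2"] powr01_less_one[OF q, of "c + 2"] powr01_less_one[OF q, of "\<gamma> + \<xi> + 2"]
    by (auto simp: g_def C_def s_def powr_add_small_numeral gC_defs S_defs)
  have br: "q_bracket (s * q ^ 2) q 2 = S2 * S1" "q_bracket (s * q ^ 4) q 2 = S4 * S3"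
    using q_bracket_2_power[OF q(1), of s 1] q_bracket_2_power[OF q(1), of s 3]
    by (simp_all add: S_defs numeral_eq_Suc)
  have e: "q powr (2 * real 1 + \<gamma> + \<xi> + 2) = s * q ^ 4" "q powr (real 1 + \<gamma> + \<xi>) = s * q"
    "q powr (real 1 + \<gamma> + \<xi> - 1) = s" "q powr (real 1 + \<gamma> + \<xi> + 1) = s * q ^ 2"
    "q powr (\<gamma> + real 1 + 1) = g * q ^ 2" "q powr (c + real 1 + 1) = C * q ^ 2"
    "q powr (\<gamma> + \<xi> + 1) = s * q" "q powr (\<gamma> + \<xi> + 2) = s * q ^ 2"
    "q powr (\<gamma> + \<xi> + 3) = s * q ^ 3" "q powr (\<gamma> + \<xi> + 4) = s * q ^ 4"
    "q powr (\<gamma> + 1) = g * q" "q powr (\<gamma> + 2) = g * q ^ 2" "q powr (c + 1) = C * q" "q powr (c + 2) = C * q ^ 2"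
    using q by (simp_all add: powr_add powr_diff s_def g_def C_def
        power2_eq_square power3_eq_cube power4_eq_xxxx)
  have n1: "((1::nat) = 0) = False" "((1::nat) = 1) = True"
    by simp_all
  note fold = s_def[symmetric] g_def[symmetric] C_def[symmetric] gC_defs[symmetric] S_defs[symmetric]
  have m2: "mu2 \<gamma> \<xi> c q 1 = q * (g1 * C1) * S0 * (S4 * S3) / S2 - q * (g2 * C2) * (S2 * S1)
      + (1 + q) * (g2 * C2) * S1 * S3 - (1 + q) * (g1 * C1) * S1 * (S4 * S3) / S2"
    unfolding mu2_def n1 if_False if_True e br fold by simp
  have m3: "mu3 \<gamma> \<xi> c q 1 = - S3 * (q * (g1 * C1) * S0 * S4 / S2
      + S1 * ((1 + q) * (g2 * C2) - (1 + q) * (g1 * C1) * S4 / S2))"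
    unfolding mu3_def n1 if_False if_True e br fold by (simp only: mult.assoc)
  have m4: "mu4 \<gamma> \<xi> c q 1 = q * (g2 * C2) * (S2 * S1)"
    unfolding mu4_def e br fold by simp
  have m5: "mu5 \<gamma> \<xi> c q 1 = - q * (1 - q) * S0 * (S4 * S3)"
    unfolding mu5_def e br fold by simp
  have m6: "mu6 \<gamma> \<xi> c q 1 = S4 * S3 * S1 * (1 - q ^ 2)"
    unfolding mu6_def e br fold by (simp add: power2_eq_square)
  note cs = coeffs_le_2[OF q(1), of \<gamma> \<xi> c, unfolded fold]
  show "mu2 \<gamma> \<xi> c q 1 + mu3 \<gamma> \<xi> c q 1 + mu4 \<gamma> \<xi> c q 1 = 0"
    unfolding m2 m3 m4 using ne by (simp add: divide_simps) (simp add: algebra_simps)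
  show "mu3 \<gamma> \<xi> c q 1 * jacobi_coeff \<gamma> \<xi> c q 1 1 + mu4 \<gamma> \<xi> c q 1 * jacobi_coeff \<gamma> \<xi> c q 2 1
       + mu5 \<gamma> \<xi> c q 1 + mu6 \<gamma> \<xi> c q 1 = 0"
    unfolding m3 m4 m5 m6 cs using ne by (simp add: divide_simps) (simp add: algebra_simps power2_eq_square)
  show "mu4 \<gamma> \<xi> c q 1 * jacobi_coeff \<gamma> \<xi> c q 2 2 + mu6 \<gamma> \<xi> c q 1 * jacobi_coeff \<gamma> \<xi> c q 1 1 = 0"
    unfolding m4 m6 cs using ne by (simp add: divide_simps) (simp add: algebra_simps power2_eq_square)
qed

section \<open>The recurrence relation\<close>

theorem theorem2p1:
  fixes q \<gamma> \<xi> c :: real and y :: "int \<Rightarrow> complex \<Rightarrow> complex" and n :: nat and z :: complex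
  assumes "0 < q" "q < 1" and "\<gamma> > -1" "\<xi> > -1" and "c > 0"
    and "\<And>k z. y (int k) z = gen_little_q_jacobi \<gamma> \<xi> c q k z"
    and "\<And>z. y (-1) z = 0" and "\<And>z. y (-2) z = 0"
  shows "of_real (mu1 \<gamma> \<xi> c q n) * y (int n - 2) z
       + (of_real (mu2 \<gamma> \<xi> c q n) + z * of_real (mu5 \<gamma> \<xi> c q n)) * y (int n - 1) z
       + (of_real (mu3 \<gamma> \<xi> c q n) + z * of_real (mu6 \<gamma> \<xi> c q n)) * y (int n) z
       + of_real (mu4 \<gamma> \<xi> c q n) * y (int n + 1) z = 0"
proof -
  \<comment> \<open>The zero polynomials of negative index get zero coefficients, so that one argument serves every \<open>n\<close>.\<close>
  define a where "a = (\<lambda>i :: int. if i < 0 then (\<lambda>_. 0) else jacobi_coeff \<gamma> \<xi> c q (nat i))"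
  have a_nat: "a (int m) = jacobi_coeff \<gamma> \<xi> c q m" for m
    by (simp add: a_def)
  have y_eq: "y i z = (\<Sum>j\<le>Suc n. of_real (a i j) * z ^ j)" if "-2 \<le> i" "i \<le> int n + 1" for i
  proof (cases "i < 0")
    case True
    then have "i = -1 \<or> i = -2"
      using that by linarith
    then show ?thesis
      using assms(7,8) by (auto simp: a_def)
  next
    case False
    then obtain m where "i = int m"
      by (metis linorder_not_less zero_le_imp_eq_int)
    then have "m \<le> Suc n"
      using that by linarith
    then show ?thesis
      unfolding \<open>i = int m\<close> a_nat assms(6) by (rule gen_little_q_jacobi_eq_sum_coeff[OF assms(1,2)])
  qed
  have par: "c > -1"
    using assms(5) by simp
  have const: "mu1 \<gamma> \<xi> c q n * a (int n - 2) 0 + mu2 \<gamma> \<xi> c q n * a (int n - 1) 0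
      + mu3 \<gamma> \<xi> c q n * a (int n) 0 + mu4 \<gamma> \<xi> c q n * a (int n + 1) 0 = 0"
  proof -
    consider "n = 0" | "n = 1" | "2 \<le> n" by linarith
    then show ?thesis
    proof cases
      case 1
      then show ?thesis
        using coeff_relations_0(1)[OF assms(1-3) par] by (simp add: a_def)
    next
      case 2
      then show ?thesis
        using coeff_relations_1(1)[OF assms(1-4) par] by (simp add: a_def)
    next
      case 3
      then show ?thesis
        by (simp add: a_def mu1_def)
    qed
  qed
  have step: "mu1 \<gamma> \<xi> c q n * a (int n - 2) (Suc k) + mu2 \<gamma> \<xi> c q n * a (int n - 1) (Suc k)
      + mu3 \<gamma> \<xi> c q n * a (int n) (Suc k) + mu4 \<gamma> \<xi> c q n * a (int n + 1) (Suc k)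
      + mu5 \<gamma> \<xi> c q n * a (int n - 1) k + mu6 \<gamma> \<xi> c q n * a (int n) k = 0" if "k \<le> n" for k
  proof -
    consider "n = 0" "k = 0" | "n = 1" "k = 0" | "n = 1" "k = 1" | "2 \<le> n"
      using \<open>k \<le> n\<close> by linarith
    then show ?thesis
    proof cases
      case 1
      then show ?thesis
        using coeff_relations_0(2)[OF assms(1-3) par, of \<xi>] assms(1)
        by (simp add: a_def jacobi_coeff_eq_0)
    next
      case 2
      then show ?thesis
        using coeff_relations_1(2)[OF assms(1-4) par] assms(1)
        by (simp add: a_def jacobi_coeff_eq_0 numeral_2_eq_2)
    next
      case 3
      then show ?thesis
        using coeff_relations_1(3)[OF assms(1-4) par] assms(1)
        by (simp add: a_def jacobi_coeff_eq_0 numeral_2_eq_2)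
    next
      case 4
      then have "int n - 2 = int (n - 2)" "int n - 1 = int (n - 1)" "int n + 1 = int (n + 1)"
        by simp_all
      then show ?thesis
        using coeff_relation_ge_2[OF assms(1-4) par 4, of k] by (simp only: a_nat)
    qed
  qed
  have top: "a (int n - 1) (Suc n) = 0" "a (int n) (Suc n) = 0"
    using assms(1) by (auto simp: a_def intro!: jacobi_coeff_eq_0)
  show ?thesis
    using four_term_relation_of_coeffs[OF const step top, of z] by (simp only: y_eq)
qed

end
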